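(* Let $\mathbb X,\mathbb Y$ be real Banach spaces, $C\subseteq\mathbb Y$ a closed convex cone with $\{0\}\neq C\neq\mathbb Y$, $K\subseteq\mathbb X$ a nonempty closed set and $f:\mathbb X\times\mathbb X\to\mathbb Y$. Let $\mathcal{SE}=\{\bar x\in K:\ f(\bar x,x)\in C\ \ \forall x\in K\}$ and $\nu(x)=\sup_{z\in K}\mathrm{dist}(f(x,z),C)\in[0,+\infty]$. Suppose that: (i) for every $z\in K$ the function $x\mapsto f(x,z)$ is $C$-u.s.c. on $K$; (ii) there exists $x_0\in K$ such that $f(x_0,K)=\{f(x_0,z):z\in K\}$ is $C$-bounded; (iii) $f$ is B-differentiable in the first argument at each point of $K\setminus\mathcal{SE}$, uniformly in $z\in K$, and $K$ is convex; (iv) there exists $\sigma>0$ such that for every $x_0\in K\setminus\mathcal{SE}$ there exists $u_0\in\mathbb S\cap\mathrm{cone}(K-x_0)$ with $$\mathrm D_Bf(\cdot,z)(x_0;u_0)+\sigma\mathbb B\subseteq C,\qquad\forall z\in K.$$ Then $\mathcal{SE}$ is nonempty and closed, and $$\mathrm{dist}(x,\mathcal{SE})\le\frac{\nu(x)}{\sigma},\qquad\forall x\in K.$$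
   Context: $\mathbb B$ and $\mathbb S$ denote the closed unit ball and unit sphere of the relevant space; $\mathrm{cone}\,A=\{\lambda a:\lambda\ge0,\ a\in A\}$ is the conical hull. $\mathrm{dist}(x,S)=\inf_{s\in S}\|x-s\|$, with $\mathrm{dist}(x,\varnothing)=+\infty$. A mapping $g:\mathbb X\to\mathbb Y$ is $C$-u.s.c. at $x_0$ if for every neighbourhood $V$ of $g(x_0)$ there is a neighbourhood $U$ of $x_0$ in $\mathbb X$ with $g(x)\in V-C$ for all $x\in U$; it is $C$-u.s.c. on a set if it is so at each point of the set. A set $S\subseteq\mathbb Y$ is $C$-bounded if there is $m\ge0$ with $S\setminus C\subseteq m\mathbb B$. $f$ is B-differentiable (in the first argument) at $x_0$, uniformly in $z\in K$, if there exist continuous positively homogeneous mappings $\mathrm D_Bf(\cdot,z)(x_0;\cdot):\mathbb X\to\mathbb Y$ ($z\in K$) such that for every $\epsilon>0$ there is $\delta>0$, independent of $z$, with $\sup_{z\in K}\frac{\|f(x,z)-f(x_0,z)-\mathrm D_Bf(\cdot,z)(x_0;x-x_0)\|}{\|x-x_0\|}\le\epsilon$ for all $x\in\mathrm B(x_0,\delta)$, $x\ne x_0$, where $\mathrm B(x_0,\delta)$ is the closed ball. *)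

theory Defs
  imports "HOL-Analysis.Analysis"
begin

text \<open>Extended-real valued distance. The infimum is taken in \<^typ>\<open>ennreal\<close>, so that the distance
  to the empty set is \<open>\<infinity>\<close>, whereas \<^const>\<open>infdist\<close> would give \<open>0\<close> there.\<close>

definition edist_set :: "'a::real_normed_vector \<Rightarrow> 'a set \<Rightarrow> ennreal"
  where "edist_set x S = (INF s\<in>S. ennreal (norm (x - s)))"

definition C_usc_at :: "'b::real_normed_vector set \<Rightarrow> ('a::real_normed_vector \<Rightarrow> 'b) \<Rightarrow> 'a \<Rightarrow> bool"
  where "C_usc_at C g x0 \<longleftrightarrow>
    (\<forall>V. open V \<and> g x0 \<in> V \<longrightarrow>
      (\<exists>U. open U \<and> x0 \<in> U \<and> (\<forall>x\<in>U. g x \<in> {v - c | v c. v \<in> V \<and> c \<in> C})))"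

text \<open>The neighbourhoods are those of the whole space, also when the points range over \<open>A\<close> only.\<close>

definition C_usc_on :: "'b::real_normed_vector set \<Rightarrow> 'a::real_normed_vector set \<Rightarrow> ('a \<Rightarrow> 'b) \<Rightarrow> bool"
  where "C_usc_on C A g \<longleftrightarrow> (\<forall>x\<in>A. C_usc_at C g x)"

definition C_bounded :: "'b::real_normed_vector set \<Rightarrow> 'b set \<Rightarrow> bool"
  where "C_bounded C S \<longleftrightarrow> (\<exists>m\<ge>0. S - C \<subseteq> cball 0 m)"

definition pos_homogeneous :: "('a::real_vector \<Rightarrow> 'b::real_vector) \<Rightarrow> bool"
  where "pos_homogeneous h \<longleftrightarrow> (\<forall>t>0. \<forall>v. h (t *\<^sub>R v) = t *\<^sub>R h v)"

text \<open>\<open>D z\<close> is the B-derivative of \<open>\<lambda>x. f x z\<close> at \<open>x0\<close>, uniformly in \<open>z \<in> K\<close>. For \<open>z \<in> K\<close> it is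
  uniquely determined, as the one-sided directional derivative. The supremum is taken in
  \<^typ>\<open>ennreal\<close>, so it is meaningful without a boundedness assumption.\<close>

definition has_unif_B_derivative ::
  "('a::real_normed_vector \<Rightarrow> 'c \<Rightarrow> 'b::real_normed_vector) \<Rightarrow> ('c \<Rightarrow> 'a \<Rightarrow> 'b) \<Rightarrow> 'c set \<Rightarrow> 'a \<Rightarrow> bool"
  where "has_unif_B_derivative f D K x0 \<longleftrightarrow>
    (\<forall>z\<in>K. continuous_on UNIV (D z) \<and> pos_homogeneous (D z)) \<and>
    (\<forall>\<epsilon>>0. \<exists>\<delta>>0. \<forall>x\<in>cball x0 \<delta>. x \<noteq> x0 \<longrightarrow>
      (SUP z\<in>K. ennreal (norm (f x z - f x0 z - D z (x - x0)) / norm (x - x0))) \<le> ennreal \<epsilon>)"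

definition SE :: "'b set \<Rightarrow> 'a set \<Rightarrow> ('a \<Rightarrow> 'a \<Rightarrow> 'b) \<Rightarrow> 'a set"
  where "SE C K f = {x \<in> K. \<forall>z\<in>K. f x z \<in> C}"

definition merit :: "'b::real_normed_vector set \<Rightarrow> 'a set \<Rightarrow> ('a \<Rightarrow> 'a \<Rightarrow> 'b) \<Rightarrow> 'a \<Rightarrow> ennreal"
  where "merit C K f x = (SUP z\<in>K. edist_set (f x z) C)"

end

theory Submission
  imports Defs
begin

text \<open>The merit function \<open>\<nu>\<close> is lower semicontinuous on \<open>K\<close>, and \<open>\<nu> x = 0\<close> holds exactly on the
  equilibrium set. If \<open>\<nu> x / \<sigma>\<close> were smaller than the distance from \<open>x\<close> to the equilibrium set, so
  would be \<open>\<nu> x / \<tau>\<close> for some \<open>\<tau> < \<sigma>\<close>, and Ekeland's principle would give a point \<open>w\<close> within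
  distance \<open>\<nu> x / \<tau>\<close> of \<open>x\<close>, hence not an equilibrium, from which \<open>\<nu>\<close> nowhere decreases at rate
  \<open>\<tau>\<close>. But moving a distance \<open>t\<close> from \<open>w\<close> in the direction of the hypothesis brings all the values
  \<open>f w z\<close> closer to \<open>C\<close> by \<open>\<sigma> t\<close>, up to an error \<open>o(t)\<close> that is uniform in \<open>z\<close>.\<close>

section \<open>Ekeland's variational principle in a complete metric space\<close>

text \<open>Closed sublevel sets express lower semicontinuity of \<open>\<phi>\<close>.
  Near-minimizers over the sets \<open>T u\<close> are chosen successively; these sets are closed,
  nested and of vanishing diameter, so completeness leaves one common point \<open>w\<close>, and
  transitivity forces \<open>T w = {w}\<close>.\<close>

lemma Ekeland_variational_principle:
  fixes \<phi> :: "'a::complete_space \<Rightarrow> real"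
  assumes sublevel: "\<And>a. closed {x \<in> S. \<phi> x \<le> a}"
    and nonneg: "\<And>x. x \<in> S \<Longrightarrow> 0 \<le> \<phi> x"
    and "x \<in> S" and c: "c > 0"
  obtains w where "w \<in> S" "\<phi> w + c * dist x w \<le> \<phi> x"
    and "\<And>y. y \<in> S \<Longrightarrow> y \<noteq> w \<Longrightarrow> \<phi> w < \<phi> y + c * dist w y"
proof -
  define T where "T = (\<lambda>x. {y \<in> S. \<phi> y + c * dist x y \<le> \<phi> x})"
  have T_refl: "y \<in> T y" if "y \<in> S" for y
    using that by (simp add: T_def)
  have T_S: "y \<in> S" if "y \<in> T u" for y u
    using that by (simp add: T_def)
  have T_trans: "T y \<subseteq> T u" if "y \<in> T u" for y u
  proof
    fix v assume "v \<in> T y"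
    moreover have "c * dist u v \<le> c * dist u y + c * dist y v"
      using c dist_triangle[of u v y] by (simp flip: distrib_left)
    ultimately show "v \<in> T u"
      using that unfolding T_def by simp
  qed
  have T_closed: "closed (T u)" for u
    unfolding closed_sequential_limits
  proof (intro allI impI, elim conjE)
    fix s l assume s: "\<forall>n. s n \<in> T u" and l: "s \<longlonglongrightarrow> l"
    have lim: "(\<lambda>n. \<phi> u - c * dist u (s n)) \<longlonglongrightarrow> \<phi> u - c * dist u l"
      by (intro tendsto_intros l)
    \<comment> \<open>The bound on \<open>\<phi> (s n)\<close> moves with \<open>n\<close>, whereas
      closedness concerns a fixed level; the slack \<open>e\<close> provides such a level and is
      then removed.\<close>
    have sub: "l \<in> S \<and> \<phi> l \<le> \<phi> u - c * dist u l + e" if "e > 0" for e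
    proof -
      have "\<forall>\<^sub>F n in sequentially. \<phi> u - c * dist u (s n) < \<phi> u - c * dist u l + e"
        using lim that by (intro order_tendstoD(2)) auto
      then have "\<forall>\<^sub>F n in sequentially. s n \<in> {x \<in> S. \<phi> x \<le> \<phi> u - c * dist u l + e}"
        by eventually_elim (use s in \<open>simp add: T_def, smt (verit)\<close>)
      from Lim_in_closed_set[OF sublevel this _ l] show ?thesis by simp
    qed
    have "\<phi> l \<le> \<phi> u - c * dist u l"
      by (rule field_le_epsilon) (use sub in blast)
    then show "l \<in> T u"
      using sub[of 1] by (simp add: T_def)
  qed
  have near_inf: "\<exists>y\<in>T u. \<forall>v\<in>T u. \<phi> y \<le> \<phi> v + e" if "u \<in> S" "e > 0" for u e
  proof -
    have ne: "\<phi> ` T u \<noteq> {}" using T_refl that by blast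
    have bdd: "bdd_below (\<phi> ` T u)"
      using nonneg T_S by (intro bdd_belowI[of _ 0]) auto
    have "Inf (\<phi> ` T u) < Inf (\<phi> ` T u) + e" using that by simp
    then obtain y where y: "y \<in> T u" "\<phi> y < Inf (\<phi> ` T u) + e"
      using cInf_lessD[OF ne] by blast
    have "\<phi> y \<le> \<phi> v + e" if "v \<in> T u" for v
      using cInf_lower[OF _ bdd, of "\<phi> v"] that y by auto
    then show ?thesis using y by blast
  qed
  define next_pt where "next_pt = (\<lambda>n u. SOME y. y \<in> T u \<and> (\<forall>v\<in>T u. \<phi> y \<le> \<phi> v + 1 / real (Suc n)))"
  have next_pt: "next_pt n u \<in> T u \<and> (\<forall>v\<in>T u. \<phi> (next_pt n u) \<le> \<phi> v + 1 / real (Suc n))"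
    if "u \<in> S" for n u
    unfolding next_pt_def
    by (rule someI_ex) (use near_inf[OF that, of "1 / real (Suc n)"] in auto)
  define s where "s = rec_nat x next_pt"
  have s_simps: "s 0 = x" "s (Suc n) = next_pt n (s n)" for n
    by (simp_all add: s_def)
  have sS: "s n \<in> S" for n
    by (induction n) (use \<open>x \<in> S\<close> next_pt[THEN conjunct1, THEN T_S] in \<open>auto simp: s_simps\<close>)
  have step: "s (Suc n) \<in> T (s n)" for n
    using next_pt sS by (simp add: s_simps)
  \<comment> \<open>The point \<open>s (Suc n)\<close> is nearly minimal over
    \<open>T (s n)\<close>, which contains \<open>T (s (Suc n))\<close>. A point \<open>v\<close> of
    the latter can thus improve \<open>\<phi>\<close> by at most the tolerance, and membership turns
    this into a distance bound.\<close>
  have close: "c * dist (s (Suc n)) v \<le> 1 / real (Suc n)" if v: "v \<in> T (s (Suc n))" for n v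
  proof -
    have "v \<in> T (s n)" using v T_trans step by blast
    then have "\<phi> (s (Suc n)) \<le> \<phi> v + 1 / real (Suc n)"
      using next_pt sS by (simp add: s_simps)
    with v show ?thesis unfolding T_def by simp
  qed
  have small: "\<exists>n. \<forall>y\<in>T (s n). \<forall>z\<in>T (s n). dist y z < e" if "e > 0" for e :: real
  proof -
    obtain n where n: "1 / real (Suc n) < c * e / 2"
      using nat_approx_posE[of "c * e / 2"] c \<open>e > 0\<close> by (metis half_gt_zero mult_pos_pos)
    have "dist (s (Suc n)) v < e / 2" if "v \<in> T (s (Suc n))" for v
    proof -
      have "c * dist (s (Suc n)) v < c * (e / 2)"
        using close[OF that] n by simp
      then show ?thesis using c by (simp only: mult_less_cancel_left_pos)
    qed
    then show ?thesis
      using dist_triangle_half_r by blast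
  qed
  have "\<exists>w. \<Inter>(range (\<lambda>n. T (s n))) = {w}"
  proof (rule decreasing_closed_nest_sing)
    show "T (s n) \<noteq> {}" for n using T_refl sS by blast
    show "T (s n) \<subseteq> T (s m)" if "m \<le> n" for m n
      by (rule lift_Suc_antimono_le[of "\<lambda>n. T (s n)"]) (use that T_trans step in auto)
  qed (use T_closed small in auto)
  then obtain w where w: "\<Inter>(range (\<lambda>n. T (s n))) = {w}" ..
  have wT: "w \<in> T (s n)" for n using w by blast
  show thesis
  proof
    show "w \<in> S" using wT T_S by blast
    show "\<phi> w + c * dist x w \<le> \<phi> x" using wT[of 0] by (simp add: s_simps T_def)
    fix y assume y: "y \<in> S" "y \<noteq> w"
    have "y \<notin> T w"
    proof
      assume "y \<in> T w"
      then have "y \<in> T (s n)" for n using T_trans wT by blast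
      then show False using w y by blast
    qed
    then show "\<phi> w < \<phi> y + c * dist w y" using y by (simp add: T_def)
  qed
qed

section \<open>Extended-real distance, merit function and equilibria\<close>

lemma le_edist_set_iff: "a \<le> edist_set x S \<longleftrightarrow> (\<forall>s\<in>S. a \<le> ennreal (norm (x - s)))"
  by (simp add: edist_set_def le_INF_iff)

lemma edist_set_eq_infdist:
  assumes "S \<noteq> {}"
  shows "edist_set x S = ennreal (infdist x S)"
proof (rule antisym)
  show "ennreal (infdist x S) \<le> edist_set x S"
    by (auto simp: le_edist_set_iff dist_norm[symmetric] intro: infdist_le ennreal_leI)
  show "edist_set x S \<le> ennreal (infdist x S)"
  proof (rule ennreal_le_epsilon)
    fix e :: real assume "e > 0"
    then have "(INF s\<in>S. dist x s) < infdist x S + e"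
      using assms by (simp add: infdist_def)
    then obtain s where s: "s \<in> S" "dist x s < infdist x S + e"
      using cINF_less_iff[of S "dist x"] assms by auto
    have "edist_set x S \<le> ennreal (dist x s)"
      unfolding edist_set_def dist_norm using s by (intro INF_lower)
    also have "\<dots> \<le> ennreal (infdist x S + e)" using s by (intro ennreal_leI) simp
    finally show "edist_set x S \<le> ennreal (infdist x S) + ennreal e"
      using \<open>e > 0\<close> by (simp add: infdist_nonneg)
  qed
qed

lemma merit_le_iff:
  assumes "C \<noteq> {}" "0 \<le> r"
  shows "merit C K f x \<le> ennreal r \<longleftrightarrow> (\<forall>z\<in>K. infdist (f x z) C \<le> r)"
  using assms by (simp add: merit_def SUP_le_iff edist_set_eq_infdist)

text \<open>Zero distance means membership because \<open>C\<close> is closed. Equilibria thus form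
  a sublevel set of the merit function, which is how their closedness is obtained.\<close>

lemma SE_eq_merit_le_0:
  assumes "closed C" "C \<noteq> {}"
  shows "SE C K f = {x \<in> K. merit C K f x \<le> ennreal 0}"
proof -
  have "y \<in> C \<longleftrightarrow> infdist y C \<le> 0" for y
    using in_closed_iff_infdist_zero[OF assms, of y] infdist_nonneg[of y C] by linarith
  then show ?thesis
    unfolding SE_def merit_le_iff[OF assms(2) order_refl] by blast
qed

section \<open>Closed sublevel sets of the merit function\<close>

text \<open>Translating \<open>d \<in> C\<close> together with \<open>v\<close> by \<open>c\<close>
  keeps it in \<open>C\<close> and leaves the distance unchanged.\<close>

lemma infdist_add_cone_le:
  fixes v :: "'a::real_normed_vector"
  assumes "convex_cone C" "c \<in> C"
  shows "infdist (v + c) C \<le> infdist v C"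
proof -
  have "C \<noteq> {}" using assms by auto
  have "infdist (v + c) C \<le> dist v d" if "d \<in> C" for d
    using that assms by (intro infdist_le2[of "d + c"]) (auto intro: convex_cone_add simp: dist_norm)
  then show ?thesis
    unfolding infdist_notempty[OF \<open>C \<noteq> {}\<close>, of v] using \<open>C \<noteq> {}\<close> by (intro cINF_greatest)
qed

text \<open>Points \<open>y\<close> of the sublevel set near a limit \<open>x\<close> satisfy
  \<open>g y = v - c\<close> with \<open>v\<close> close to \<open>g x\<close>. Passing from
  \<open>g y\<close> to \<open>v = g y + c\<close> does not increase the distance to
  \<open>C\<close>, so only the small distance from \<open>v\<close> to \<open>g x\<close> is
  lost.\<close>

lemma closed_infdist_sublevel_C_usc:
  assumes C: "convex_cone C" and "closed K" and usc: "C_usc_on C K g"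
  shows "closed {x \<in> K. infdist (g x) C \<le> r}"
  unfolding closure_subset_eq[symmetric]
proof
  fix x assume x: "x \<in> closure {x \<in> K. infdist (g x) C \<le> r}"
  then have "x \<in> closure K" using closure_mono[of "{x \<in> K. infdist (g x) C \<le> r}" K] by blast
  then have "x \<in> K" using \<open>closed K\<close> by simp
  moreover have "infdist (g x) C \<le> r"
  proof (rule field_le_epsilon)
    fix e :: real assume "e > 0"
    then have "open (ball (g x) e) \<and> g x \<in> ball (g x) e" by simp
    then obtain U where U: "open U" "x \<in> U" "\<forall>y\<in>U. g y \<in> {v - c | v c. v \<in> ball (g x) e \<and> c \<in> C}"
      using usc \<open>x \<in> K\<close> unfolding C_usc_on_def C_usc_at_def by meson
    then obtain y where y: "y \<in> U" "infdist (g y) C \<le> r"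
      using x open_Int_closure_eq_empty[of U "{x \<in> K. infdist (g x) C \<le> r}"] by blast
    then obtain v c where v: "g y = v - c" "dist (g x) v < e" "c \<in> C"
      using U by auto
    have "infdist (g x) C \<le> infdist v C + dist (g x) v" by (rule infdist_triangle)
    also have "infdist v C \<le> infdist (g y) C"
      using infdist_add_cone_le[OF C \<open>c \<in> C\<close>, of "g y"] v by simp
    finally show "infdist (g x) C \<le> r + e" using y v by simp
  qed
  ultimately show "x \<in> {x \<in> K. infdist (g x) C \<le> r}" by simp
qed

lemma closed_merit_sublevel:
  assumes "convex_cone C" "closed K" "K \<noteq> {}" "\<forall>z\<in>K. C_usc_on C K (\<lambda>x. f x z)" "0 \<le> r"
  shows "closed {x \<in> K. merit C K f x \<le> ennreal r}"
proof -
  have "{x \<in> K. merit C K f x \<le> ennreal r} = (\<Inter>z\<in>K. {x \<in> K. infdist (f x z) C \<le> r})"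
    using assms by (auto simp: merit_le_iff convex_cone_nonempty)
  then show ?thesis
    using assms by (auto intro!: closed_infdist_sublevel_C_usc)
qed

section \<open>Decrease of the merit function along the given direction\<close>

text \<open>The ball of radius \<open>\<sigma> * t\<close> about \<open>t *\<^sub>R p\<close> lies
  in \<open>C\<close>. Adding it to a point \<open>c\<close> of \<open>C\<close> absorbs a portion
  of \<open>a - c\<close> of length up to \<open>\<sigma> * t\<close>, so the distance drops by this
  amount or vanishes.\<close>

lemma infdist_add_scaled_interior_direction:
  assumes C: "convex_cone C" and p: "\<And>b. norm b \<le> 1 \<Longrightarrow> p + \<sigma> *\<^sub>R b \<in> C"
    and "0 \<le> t" "0 \<le> \<sigma>"
  shows "infdist (a + t *\<^sub>R p) C \<le> max 0 (infdist a C - \<sigma> * t)"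
proof -
  have "C \<noteq> {}" using C convex_cone_nonempty by blast
  have bound: "infdist (a + t *\<^sub>R p) C \<le> max 0 (dist a c - \<sigma> * t)" if "c \<in> C" for c
  proof (cases "dist a c \<le> \<sigma> * t")
    case True
    have "t *\<^sub>R p + (a - c) \<in> C"
    \<comment> \<open>The degenerate case forces \<open>a = c\<close>; it is separated because the
      rescaling below divides by \<open>\<sigma> * t\<close>.\<close>
    proof (cases "\<sigma> * t = 0")
      case True
      then have "a - c = 0" using \<open>dist a c \<le> \<sigma> * t\<close> by (simp only: dist_le_zero_iff) simp
      moreover have "t *\<^sub>R p \<in> C" using p[of 0] C \<open>0 \<le> t\<close> by (simp add: convex_cone_scaleR)
      ultimately show ?thesis by simp
    next
      case False
      then have pos: "\<sigma> * t > 0" using assms by (simp add: order_less_le)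
      have "norm ((1 / (\<sigma> * t)) *\<^sub>R (a - c)) \<le> 1"
        using True pos assms by (simp add: dist_norm divide_simps)
      from convex_cone_scaleR[OF C \<open>0 \<le> t\<close> p[OF this]] False
      show ?thesis by (simp add: scaleR_add_right)
    qed
    from convex_cone_add[OF C this that] have "a + t *\<^sub>R p \<in> C" by (simp add: algebra_simps)
    then show ?thesis by simp
  next
    case False
    define d where "d = dist a c"
    have d: "d > 0" "\<sigma> * t < d" using False assms by (auto simp: d_def intro: le_less_trans[of 0 "\<sigma> * t"])
    have "norm ((1 / d) *\<^sub>R (a - c)) \<le> 1" by (simp add: d_def dist_norm)
    from convex_cone_scaleR[OF C \<open>0 \<le> t\<close> p[OF this]]
    have "c + (t *\<^sub>R p + (\<sigma> * t / d) *\<^sub>R (a - c)) \<in> C"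
      using convex_cone_add[OF C that] by (simp add: scaleR_add_right mult.commute)
    moreover have "dist (a + t *\<^sub>R p) (c + (t *\<^sub>R p + (\<sigma> * t / d) *\<^sub>R (a - c))) = d - \<sigma> * t"
    proof -
      have "a + t *\<^sub>R p - (c + (t *\<^sub>R p + (\<sigma> * t / d) *\<^sub>R (a - c))) = (1 - \<sigma> * t / d) *\<^sub>R (a - c)"
        by (simp add: algebra_simps)
      then have "dist (a + t *\<^sub>R p) (c + (t *\<^sub>R p + (\<sigma> * t / d) *\<^sub>R (a - c))) = \<bar>1 - \<sigma> * t / d\<bar> * d"
        by (simp add: dist_norm d_def)
      also have "\<dots> = d - \<sigma> * t" using d by (simp add: field_simps)
      finally show ?thesis .
    qed
    ultimately show ?thesis
      unfolding d_def by (intro infdist_le2[THEN order_trans[OF _ max.cobounded2]]) auto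
  qed
  show ?thesis
  \<comment> \<open>The infimum defining \<open>infdist a C\<close> need not be attained, so a
    violation is refuted with a nearly closest \<open>c\<close>.\<close>
  proof (rule ccontr)
    assume "\<not> ?thesis"
    then have less: "infdist a C < infdist (a + t *\<^sub>R p) C + \<sigma> * t" and pos: "0 < infdist (a + t *\<^sub>R p) C"
      by auto
    then obtain c where "c \<in> C" "dist a c < infdist (a + t *\<^sub>R p) C + \<sigma> * t"
      using cINF_less_iff[of C "dist a"] \<open>C \<noteq> {}\<close> by (auto simp: infdist_notempty)
    with bound[of c] pos show False by auto
  qed
qed

text \<open>A step of length \<open>t\<close> along \<open>u\<close> gains
  \<open>\<sigma> * t\<close> by the cone condition and loses at most
  \<open>(\<sigma> - \<tau>) * t\<close> to the uniform remainder: a net decrease of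
  \<open>\<tau> * t\<close> for all \<open>z\<close> at once.\<close>

lemma merit_descent:
  assumes C: "closed C" "convex_cone C"
    and K: "convex K" "x \<in> K" "x \<notin> SE C K f" and fin: "merit C K f x < \<infinity>"
    and diff: "has_unif_B_derivative f D K x"
    and u: "norm u = 1" "u \<in> cone hull ((\<lambda>y. y - x) ` K)"
    and dir: "\<And>z b. z \<in> K \<Longrightarrow> norm b \<le> 1 \<Longrightarrow> D z u + \<sigma> *\<^sub>R b \<in> C"
    and \<tau>: "0 \<le> \<tau>" "\<tau> < \<sigma>"
  obtains y where "y \<in> K" "y \<noteq> x" "merit C K f y + ennreal (\<tau> * dist x y) \<le> merit C K f x"
proof -
  have "C \<noteq> {}" using C convex_cone_nonempty by blast
  define m where "m = enn2real (merit C K f x)"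
  have m: "merit C K f x = ennreal m" "0 \<le> m"
    using fin by (simp_all add: m_def less_top)
  have "\<not> merit C K f x \<le> ennreal 0"
    using K SE_eq_merit_le_0[OF C(1) \<open>C \<noteq> {}\<close>, of K f] by blast
  then have "m > 0" using m by simp
  obtain q k where k: "k \<in> K" "u = q *\<^sub>R (k - x)" "0 \<le> q"
    using u(2) unfolding cone_hull_expl by blast
  with u(1) have "q > 0" by (cases "q = 0") auto
  obtain \<delta> where "\<delta> > 0" and \<delta>: "\<And>y. y \<in> cball x \<delta> \<Longrightarrow> y \<noteq> x \<Longrightarrow>
      (SUP z\<in>K. ennreal (norm (f y z - f x z - D z (y - x)) / norm (y - x))) \<le> ennreal (\<sigma> - \<tau>)"
    using diff \<tau> unfolding has_unif_B_derivative_def by (meson diff_gt_0_iff_gt)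
  \<comment> \<open>The bound \<open>\<delta>\<close> controls the remainder, \<open>1 / q\<close>
    keeps the new point on the segment from \<open>x\<close> to \<open>k\<close>, and
    \<open>m / \<sigma>\<close> keeps \<open>m - \<sigma> * t\<close> nonnegative, so that the
    maximum with \<open>0\<close> does no harm.\<close>
  define t where "t = min \<delta> (min (1 / q) (m / \<sigma>))"
  have t: "t > 0" "t \<le> \<delta>" "t * q \<le> 1" "\<sigma> * t \<le> m"
  proof -
    show "t > 0" using \<open>\<delta> > 0\<close> \<open>q > 0\<close> \<open>m > 0\<close> \<tau> by (simp add: t_def)
    show "t \<le> \<delta>" by (simp add: t_def)
    have "t \<le> 1 / q" "t \<le> m / \<sigma>" by (simp_all add: t_def)
    then show "t * q \<le> 1" "\<sigma> * t \<le> m" using \<open>q > 0\<close> \<tau> by (simp_all add: field_simps)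
  qed
  define y where "y = x + t *\<^sub>R u"
  have "y = (1 - t * q) *\<^sub>R x + (t * q) *\<^sub>R k" by (simp add: y_def k algebra_simps)
  then have "y \<in> K" using K k t \<open>q > 0\<close> by (auto intro: convexD_alt)
  have norm_y: "norm (y - x) = t" "dist x y = t" using t u by (simp_all add: y_def dist_norm)
  then have "y \<noteq> x" using t by auto
  have "infdist (f y z) C \<le> m - \<tau> * t" if z: "z \<in> K" for z
  proof -
    have "ennreal (norm (f y z - f x z - D z (y - x)) / norm (y - x)) \<le> ennreal (\<sigma> - \<tau>)"
      using \<delta>[of y] norm_y t \<open>y \<noteq> x\<close> z by (auto simp: SUP_le_iff)
    then have "norm (f y z - f x z - D z (y - x)) \<le> (\<sigma> - \<tau>) * t"
      using t \<tau> norm_y by (simp add: field_simps)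
    moreover have "D z (y - x) = t *\<^sub>R D z u"
      using diff z t by (simp add: has_unif_B_derivative_def pos_homogeneous_def y_def)
    ultimately have rem: "dist (f y z) (f x z + t *\<^sub>R D z u) \<le> (\<sigma> - \<tau>) * t"
      by (simp add: dist_norm algebra_simps)
    have "infdist (f x z) C \<le> m"
      using m z \<open>C \<noteq> {}\<close> merit_le_iff[of C m K f x] by simp
    moreover have "infdist (f x z + t *\<^sub>R D z u) C \<le> max 0 (infdist (f x z) C - \<sigma> * t)"
      using C dir[OF z] t \<tau> by (intro infdist_add_scaled_interior_direction) auto
    ultimately have "infdist (f x z + t *\<^sub>R D z u) C \<le> m - \<sigma> * t"
      using t by simp
    then show ?thesis
      using infdist_triangle[of "f y z" C "f x z + t *\<^sub>R D z u"] rem by (simp add: algebra_simps)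
  qed
  moreover have "0 \<le> m - \<tau> * t"
    using t(4) mult_right_mono[OF less_imp_le[OF \<tau>(2)] less_imp_le[OF t(1)]] by linarith
  ultimately have "merit C K f y \<le> ennreal (m - \<tau> * t)"
    using \<open>C \<noteq> {}\<close> by (simp add: merit_le_iff)
  then have "merit C K f y + ennreal (\<tau> * t) \<le> ennreal (m - \<tau> * t) + ennreal (\<tau> * t)"
    by (rule add_right_mono)
  also have "\<dots> = ennreal m"
    using \<open>0 \<le> m - \<tau> * t\<close> \<tau> t by (simp flip: ennreal_plus)
  finally show thesis
    using that \<open>y \<in> K\<close> \<open>y \<noteq> x\<close> norm_y m by simp
qed

section \<open>From descent to an error bound\<close>

lemma edist_set_le_of_descent:
  fixes \<phi> :: "'a::banach \<Rightarrow> ennreal"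
  assumes sublevel: "\<And>r. 0 \<le> r \<Longrightarrow> closed {x \<in> K. \<phi> x \<le> ennreal r}"
    and \<tau>: "\<tau> > 0"
    and descent: "\<And>x. x \<in> K - S \<Longrightarrow> \<phi> x < \<infinity> \<Longrightarrow>
      \<exists>y\<in>K. y \<noteq> x \<and> \<phi> y + ennreal (\<tau> * dist x y) \<le> \<phi> x"
    and x: "x \<in> K" "\<phi> x = ennreal r" "0 \<le> r"
  shows "edist_set x S \<le> ennreal (r / \<tau>)"
proof -
  \<comment> \<open>On this set \<open>\<phi>\<close> is finite, so \<open>enn2real\<close> loses
    nothing. A descent step from a point of the set stays in it, so minimality of \<open>w\<close>
    within the set suffices.\<close>
  let ?K = "{y \<in> K. \<phi> y \<le> ennreal r}"
  have fin: "\<phi> y = ennreal (enn2real (\<phi> y))" if "y \<in> ?K" for y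
    using that by (auto simp: less_top[symmetric] dest: neq_top_trans[OF ennreal_neq_top])
  have level: "enn2real (\<phi> y) \<le> a \<longleftrightarrow> \<phi> y \<le> ennreal a" if "y \<in> ?K" "0 \<le> a" for y a
    using fin[OF that(1)] that(2) by (metis ennreal_le_iff)
  have "closed {y \<in> ?K. enn2real (\<phi> y) \<le> a}" for a
  proof (cases "0 \<le> a")
    case True
    then have "{y \<in> ?K. enn2real (\<phi> y) \<le> a} = {y \<in> K. \<phi> y \<le> ennreal r} \<inter> {y \<in> K. \<phi> y \<le> ennreal a}"
      using level by blast
    then show ?thesis using sublevel True x by auto
  next
    case False
    then have "{y \<in> ?K. enn2real (\<phi> y) \<le> a} = {}"
      using enn2real_nonneg order_trans by blast
    then show ?thesis by (simp only: closed_empty)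
  qed
  then obtain w where w: "w \<in> ?K" "enn2real (\<phi> w) + \<tau> * dist x w \<le> enn2real (\<phi> x)"
    and min: "\<And>y. y \<in> ?K \<Longrightarrow> y \<noteq> w \<Longrightarrow> enn2real (\<phi> w) < enn2real (\<phi> y) + \<tau> * dist w y"
    by (rule Ekeland_variational_principle[of ?K "\<lambda>y. enn2real (\<phi> y)" x \<tau>]) (use x \<tau> in auto)
  have "w \<in> S"
  proof (rule ccontr)
    assume "w \<notin> S"
    moreover have "\<phi> w < \<infinity>" using fin[OF w(1)] ennreal_less_top by (metis infinity_ennreal_def)
    ultimately obtain y where y: "y \<in> K" "y \<noteq> w" "\<phi> y + ennreal (\<tau> * dist w y) \<le> \<phi> w"
      using descent[of w] w by blast
    then have "\<phi> y \<le> \<phi> w" by (metis le_iff_add add.assoc)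
    then have yK: "y \<in> ?K" using y w by auto
    have "ennreal (enn2real (\<phi> y) + \<tau> * dist w y) \<le> ennreal (enn2real (\<phi> w))"
      using y(3) fin[OF yK] fin[OF w(1)] \<tau> by simp
    then show False using min[OF yK y(2)] by (simp add: ennreal_le_iff)
  qed
  have "\<tau> * dist x w \<le> r"
  proof -
    have "enn2real (\<phi> x) = r" using x by simp
    then show ?thesis using w(2) enn2real_nonneg[of "\<phi> w"] by linarith
  qed
  then have "dist x w \<le> r / \<tau>" using \<tau> by (simp add: field_simps)
  have "edist_set x S \<le> ennreal (norm (x - w))"
    unfolding edist_set_def using \<open>w \<in> S\<close> by (rule INF_lower)
  also have "\<dots> \<le> ennreal (r / \<tau>)"
    using \<open>dist x w \<le> r / \<tau>\<close> by (intro ennreal_leI) (simp add: dist_norm)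
  finally show ?thesis .
qed

section \<open>Existence of equilibria and the bound with the sharp constant
  \<open>\<sigma>\<close>\<close>

theorem corollary3p8:
  fixes C :: "'b::banach set"
    and K :: "'a::banach set"
    and f :: "'a \<Rightarrow> 'a \<Rightarrow> 'b"
    and DB :: "'a \<Rightarrow> 'a \<Rightarrow> 'a \<Rightarrow> 'b"  \<comment> \<open>\<open>DB z x u\<close> is the B-derivative of \<open>f(\<cdot>,z)\<close> at \<open>x\<close>, applied to \<open>u\<close>\<close>
    and \<sigma> :: real
  assumes C: "closed C" "convex C" "cone C" "C \<noteq> {}" "C \<noteq> {0}" "C \<noteq> UNIV"
    and K: "closed K" "K \<noteq> {}"
    and usc: "\<forall>z\<in>K. C_usc_on C K (\<lambda>x. f x z)"
    and bdd: "\<exists>x0\<in>K. C_bounded C (f x0 ` K)"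
    and B_diff: "\<forall>x0 \<in> K - SE C K f. has_unif_B_derivative f (\<lambda>z. DB z x0) K x0"
    and K_convex: "convex K"
    and \<sigma>: "\<sigma> > 0"
    and dir: "\<forall>x0 \<in> K - SE C K f.
      \<exists>u0 \<in> sphere 0 1 \<inter> cone hull ((\<lambda>y. y - x0) ` K).
        \<forall>z\<in>K. (\<lambda>b. DB z x0 u0 + \<sigma> *\<^sub>R b) ` cball 0 1 \<subseteq> C"
  shows "SE C K f \<noteq> {} \<and> closed (SE C K f) \<and>
    (\<forall>x\<in>K. edist_set x (SE C K f) \<le> merit C K f x / ennreal \<sigma>)"
proof (intro conjI ballI)
  have cone: "convex_cone C"
    using C by (simp add: convex_cone_def conic_def cone_def)
  note sublevel = closed_merit_sublevel[OF cone K usc]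
  show "closed (SE C K f)"
    unfolding SE_eq_merit_le_0[OF C(1,4)] by (rule sublevel) simp
  \<comment> \<open>The rate \<open>\<tau>\<close> stays strictly below \<open>\<sigma>\<close> to
    leave room for the remainder of the B-derivative.\<close>
  have bound: "edist_set x (SE C K f) \<le> ennreal (r / \<tau>)"
    if x: "x \<in> K" "merit C K f x = ennreal r" "0 \<le> r" and \<tau>: "0 < \<tau>" "\<tau> < \<sigma>" for x r \<tau>
  proof (rule edist_set_le_of_descent[OF sublevel])
    fix w assume w: "w \<in> K - SE C K f" "merit C K f w < \<infinity>"
    from dir w(1) obtain u where u: "norm u = 1" "u \<in> cone hull ((\<lambda>y. y - w) ` K)"
      and uC: "\<forall>z\<in>K. (\<lambda>b. DB z w u + \<sigma> *\<^sub>R b) ` cball 0 1 \<subseteq> C"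
      by (meson IntE mem_sphere_0)
    obtain y where "y \<in> K" "y \<noteq> w" "merit C K f y + ennreal (\<tau> * dist w y) \<le> merit C K f w"
      by (rule merit_descent[of C K w f "\<lambda>z. DB z w" u \<sigma> \<tau>])
        (use C(1) cone K_convex w B_diff u uC \<tau> in \<open>auto simp: subset_iff\<close>)
    then show "\<exists>y\<in>K. y \<noteq> w \<and> merit C K f y + ennreal (\<tau> * dist w y) \<le> merit C K f w"
      by blast
  qed (use x \<tau> in auto)
  obtain x0 m where x0: "x0 \<in> K" "m \<ge> 0" "f x0 ` K - C \<subseteq> cball 0 m"
    using bdd by (auto simp: C_bounded_def)
  \<comment> \<open>Values outside \<open>C\<close> have norm at most \<open>m\<close>, and
    \<open>0 \<in> C\<close>; hence the merit is finite at \<open>x0\<close>.\<close>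
  have "infdist (f x0 z) C \<le> m" if "z \<in> K" for z
  proof (cases "f x0 z \<in> C")
    case False
    then have "f x0 z \<in> cball 0 m" using that x0 by blast
    then show ?thesis
      using convex_cone_contains_0[OF cone] by (intro infdist_le2[of 0]) (auto simp: dist_commute)
  qed (use x0 in simp)
  then have "merit C K f x0 \<le> ennreal m" using C x0 by (simp add: merit_le_iff)
  then have "merit C K f x0 = ennreal (enn2real (merit C K f x0))"
    by (auto simp: less_top[symmetric] dest: neq_top_trans[OF ennreal_neq_top])
  \<comment> \<open>Any rate strictly between \<open>0\<close> and \<open>\<sigma>\<close> serves
    here. Finiteness yields nonemptiness, since the infimum over the empty set is infinite.\<close>
  from bound[OF x0(1) this, of "\<sigma> / 2"] \<sigma>
  have "edist_set x0 (SE C K f) < \<infinity>" by (simp add: le_less_trans[OF _ ennreal_less_top])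
  then show "SE C K f \<noteq> {}" by (auto simp: edist_set_def)
  fix x assume x: "x \<in> K"
  show "edist_set x (SE C K f) \<le> merit C K f x / ennreal \<sigma>"
  proof (cases "merit C K f x")
    case (real r)
    \<comment> \<open>Letting \<open>\<tau>\<close> increase to \<open>\<sigma>\<close> recovers the
      constant \<open>\<sigma>\<close> itself.\<close>
    have "((\<lambda>\<tau>. r / \<tau>) \<longlongrightarrow> r / \<sigma>) (at_left \<sigma>)"
      using \<sigma> by (intro tendsto_intros) auto
    then have lim: "((\<lambda>\<tau>. ennreal (r / \<tau>)) \<longlongrightarrow> ennreal (r / \<sigma>)) (at_left \<sigma>)"
      by (rule tendsto_ennrealI)
    have "\<forall>\<^sub>F \<tau> in at_left \<sigma>. edist_set x (SE C K f) \<le> ennreal (r / \<tau>)"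
      using eventually_at_left_real[OF \<sigma>]
      by eventually_elim (use bound[OF x] real in auto)
    from tendsto_lowerbound[OF lim this] show ?thesis
      using real \<sigma> by (simp add: divide_ennreal)
  next
    case top
    then show ?thesis by (simp add: ennreal_top_divide)
  qed
qed

end
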